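(* For all integers $t\geqslant s\geqslant 7$, $C(n,K_{s,t})=\Omega(n^{2/3})$ as $n\to\infty$.
   Context: For a graph $H$ and a positive integer $n$, $C(n,H)$ denotes the minimum integer $k$ such that there exist $n$ colorings $f_v:E(K_n)\to[k]$, one for each vertex $v\in V(K_n)$ (the colorings need not be proper), with the following property: for every copy $T$ of $H$ in $K_n$, there is a vertex $v\in V(T)$ such that $f_v$ assigns pairwise distinct colors to all edges of $E(T)$. $K_{s,t}$ is the complete bipartite graph with parts of sizes $s$ and $t$. *)

theory Defs
  imports Complex_Main "HOL-Library.FuncSet" "HOL-Library.Landau_Symbols"
begin

type_synonym 'a sgraph = "'a set \<times> 'a set set"

abbreviation verts :: "'a sgraph \<Rightarrow> 'a set" where
  "verts G \<equiv> fst G"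

abbreviation edges :: "'a sgraph \<Rightarrow> 'a set set" where
  "edges G \<equiv> snd G"

definition simple_graph :: "'a sgraph \<Rightarrow> bool" where
  "simple_graph G \<longleftrightarrow> (\<forall>e\<in>edges G. e \<subseteq> verts G \<and> card e = 2)"

definition subgraph :: "'a sgraph \<Rightarrow> 'a sgraph \<Rightarrow> bool" where
  "subgraph T G \<longleftrightarrow> simple_graph T \<and> verts T \<subseteq> verts G \<and> edges T \<subseteq> edges G"

definition isomorphic :: "'a sgraph \<Rightarrow> 'b sgraph \<Rightarrow> bool" where
  "isomorphic G H \<longleftrightarrow> (\<exists>\<phi>. bij_betw \<phi> (verts G) (verts H) \<and> edges H = (\<lambda>e. \<phi> ` e) ` edges G)"

text \<open>Copies are not required to be induced.\<close>

definition copy_of :: "'a sgraph \<Rightarrow> 'b sgraph \<Rightarrow> 'a sgraph \<Rightarrow> bool" where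
  "copy_of T H G \<longleftrightarrow> subgraph T G \<and> isomorphic H T"

definition complete_graph :: "nat \<Rightarrow> nat sgraph" where
  "complete_graph n = ({1..n}, {e. e \<subseteq> {1..n} \<and> card e = 2})"

definition complete_bipartite :: "nat \<Rightarrow> nat \<Rightarrow> (nat + nat) sgraph" where
  "complete_bipartite s t =
     ({1..s} <+> {1..t}, {{Inl i, Inr j} | i j. i \<in> {1..s} \<and> j \<in> {1..t}})"

definition locally_rainbow :: "nat \<Rightarrow> 'b sgraph \<Rightarrow> nat \<Rightarrow> (nat \<Rightarrow> nat set \<Rightarrow> nat) \<Rightarrow> bool" where
  "locally_rainbow n H k f \<longleftrightarrow>
     (\<forall>v\<in>verts (complete_graph n). f v \<in> edges (complete_graph n) \<rightarrow> {1..k}) \<and>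
     (\<forall>T. copy_of T H (complete_graph n) \<longrightarrow> (\<exists>v\<in>verts T. inj_on (f v) (edges T)))"

definition local_rainbow_number :: "nat \<Rightarrow> 'b sgraph \<Rightarrow> nat" where
  "local_rainbow_number n H = (LEAST k. \<exists>f. locally_rainbow n H k f)"

text \<open>The minimum is taken over a nonempty set as soon as \<open>H\<close> has a vertex: use the same
  injective coloring at every vertex.\<close>

lemma locally_rainbow_exists:
  fixes H :: "'b sgraph"
  assumes "verts H \<noteq> {}"
  shows "\<exists>k f. locally_rainbow n H k f"
proof -
  let ?E = "edges (complete_graph n)"
  have "finite ?E"
    by (rule finite_subset[of _ "Pow {1..n}"]) (auto simp: complete_graph_def)
  then obtain h where h: "bij_betw h ?E {1..card ?E}"
    using finite_same_card_bij[of ?E "{1..card ?E}"] by auto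
  have "locally_rainbow n H (card ?E) (\<lambda>_. h)"
    unfolding locally_rainbow_def
  proof (intro conjI ballI allI impI)
    show "h \<in> ?E \<rightarrow> {1..card ?E}"
      using h by (auto simp: bij_betw_def)
  next
    fix T :: "nat sgraph"
    assume T: "copy_of T H (complete_graph n)"
    then have "verts T \<noteq> {}"
      using assms by (auto simp: copy_of_def isomorphic_def bij_betw_def)
    moreover have "inj_on h (edges T)"
      using T h by (auto simp: copy_of_def subgraph_def bij_betw_def intro: inj_on_subset)
    ultimately show "\<exists>v\<in>verts T. inj_on h (edges T)" by blast
  qed
  then show ?thesis by blast
qed

lemma simple_graph_complete_bipartite: "simple_graph (complete_bipartite s t)"
  by (auto simp: simple_graph_def complete_bipartite_def)

end

theory Submission
  imports Defs
begin

text \<open>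
  Suppose that \<open>k\<close> colors suffice, where \<open>k \<le> n\<^bsup>2/3\<^esup> / 30\<close>. Fix a vertex \<open>x\<close>. Averaging over the
  pairs of edges at \<open>x\<close> yields a cherry \<open>a x b\<close> that is monochromatic under \<open>f\<^sub>v\<close> for a set \<open>S\<close> of
  order \<open>n / k\<close> vertices \<open>v\<close>, so any copy of \<open>K\<^bsub>s,t\<^esub>\<close> that contains the cherry can only be rainbow
  for the vertices outside \<open>S\<close>. Split \<open>S\<close> into two halves. There are more than \<open>3 k\<close> edges
  between them, so one of these edges shares its color with another one under each of \<open>f\<^sub>x\<close>, \<open>f\<^sub>a\<close>
  and \<open>f\<^sub>b\<close>. The cherry and these at most four edges fit into a copy of \<open>K\<^bsub>5,6\<^esub>\<close>, and filling it up
  with vertices of \<open>S\<close> gives a copy of \<open>K\<^bsub>s,t\<^esub>\<close> that is rainbow for none of its vertices.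
\<close>

section \<open>Pigeonhole and averaging for repeated colors\<close>

text \<open>Choose one representative in each color class. There are at most \<open>card C\<close>
  of them, and every other element of \<open>A\<close> forms a monochromatic pair with the
  representative of its class.\<close>

lemma card_monochromatic_pairs_ge:
  assumes "finite A" "g ` A \<subseteq> C" "finite C"
  shows "card A - card C \<le> card {p \<in> A \<times> A. fst p \<noteq> snd p \<and> g (fst p) = g (snd p)}"
proof -
  let ?r = "inv_into A g"
  let ?B = "A - ?r ` g ` A"
  have rep: "?r (g a) \<in> A" "g (?r (g a)) = g a" if "a \<in> A" for a
    using that by (auto simp: inv_into_into f_inv_into_f)
  have "card (?r ` g ` A) \<le> card C"
    using assms by (meson card_image_le card_mono finite_imageI order_trans)
  then have "card A - card C \<le> card ?B"
    using diff_card_le_card_Diff[of "?r ` g ` A" A] assms(1) by auto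
  also have "\<dots> \<le> card {p \<in> A \<times> A. fst p \<noteq> snd p \<and> g (fst p) = g (snd p)}"
  proof (rule card_inj_on_le[of "\<lambda>a. (a, ?r (g a))"])
    show "inj_on (\<lambda>a. (a, ?r (g a))) ?B"
      by (auto simp: inj_on_def)
    show "(\<lambda>a. (a, ?r (g a))) ` ?B \<subseteq> {p \<in> A \<times> A. fst p \<noteq> snd p \<and> g (fst p) = g (snd p)}"
    proof (clarsimp, intro conjI)
      fix a assume a: "a \<in> A" "a \<notin> ?r ` g ` A"
      then show "?r (g a) \<in> A" "g a = g (?r (g a))" "a \<noteq> ?r (g a)"
        using rep[OF a(1)] by auto
    qed
    show "finite {p \<in> A \<times> A. fst p \<noteq> snd p \<and> g (fst p) = g (snd p)}"
      using assms(1) by simp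
  qed
  finally show ?thesis .
qed

text \<open>Count the triples \<open>(v, a, b)\<close> with \<open>a \<noteq> b\<close> and
  \<open>g v a = g v b\<close> in two ways. Every \<open>v\<close> contributes at least
  \<open>card A - card C\<close> ordered pairs, whereas fewer than \<open>(card A)^2\<close> pairs
  with at most \<open>N\<close> vertices each would not add up to the required total.\<close>

lemma exists_pair_often_monochromatic:
  fixes g :: "'v \<Rightarrow> 'a \<Rightarrow> 'c"
  assumes "finite A" "finite V" "finite C" and col: "\<And>v. v \<in> V \<Longrightarrow> g v ` A \<subseteq> C"
    and big: "card A * card A * N < card V * (card A - card C)"
  shows "\<exists>a\<in>A. \<exists>b\<in>A. a \<noteq> b \<and> N < card {v \<in> V. g v a = g v b}"
proof (rule ccontr)
  assume *: "\<not> ?thesis"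
  let ?P = "{p \<in> A \<times> A. fst p \<noteq> snd p}"
  have "card V * (card A - card C) = (\<Sum>v\<in>V. card A - card C)"
    by simp
  also have "\<dots> \<le> (\<Sum>v\<in>V. card {p \<in> ?P. g v (fst p) = g v (snd p)})"
  proof (rule sum_mono)
    fix v assume "v \<in> V"
    have "{p \<in> ?P. g v (fst p) = g v (snd p)}
        = {p \<in> A \<times> A. fst p \<noteq> snd p \<and> g v (fst p) = g v (snd p)}"
      by auto
    then show "card A - card C \<le> card {p \<in> ?P. g v (fst p) = g v (snd p)}"
      using card_monochromatic_pairs_ge[OF assms(1) col[OF \<open>v \<in> V\<close>] assms(3)] by metis
  qed
  also have "\<dots> = (\<Sum>p\<in>?P. card {v \<in> V. g v (fst p) = g v (snd p)})"
    using assms(1,2) by (intro sum_multicount_gen[symmetric]) auto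
  also have "\<dots> \<le> (\<Sum>p\<in>?P. N)"
    using * by (intro sum_mono) (fastforce simp: not_less)
  also have "\<dots> \<le> card A * card A * N"
    using card_mono[of "A \<times> A" ?P] assms(1) by (auto simp: card_cartesian_product)
  finally show False
    using big by simp
qed

lemma card_uniquely_colored_le:
  assumes "finite C" "g ` E \<subseteq> C"
  shows "card {e \<in> E. \<forall>e'\<in>E. g e' = g e \<longrightarrow> e' = e} \<le> card C"
  using assms by (intro card_inj_on_le[of g]) (auto simp: inj_on_def)

text \<open>For each \<open>i\<close>, the elements whose color under \<open>g i\<close> is unique
  inject into \<open>C\<close>. The union of these sets over \<open>I\<close> is too small to cover
  \<open>E\<close>.\<close>

lemma exists_commonly_repeated:
  assumes "finite I" "finite E" "finite C" and col: "\<And>i. i \<in> I \<Longrightarrow> g i ` E \<subseteq> C"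
    and big: "card I * card C < card E"
  shows "\<exists>e\<in>E. \<forall>i\<in>I. \<exists>e'\<in>E. e' \<noteq> e \<and> g i e' = g i e"
proof -
  let ?U = "\<lambda>i. {e \<in> E. \<forall>e'\<in>E. g i e' = g i e \<longrightarrow> e' = e}"
  have "card (\<Union>i\<in>I. ?U i) \<le> (\<Sum>i\<in>I. card (?U i))"
    using assms(1) by (rule card_UN_le)
  also have "\<dots> \<le> (\<Sum>i\<in>I. card C)"
    using card_uniquely_colored_le[OF assms(3) col] by (intro sum_mono) auto
  finally have "card (\<Union>i\<in>I. ?U i) < card E"
    using big by simp
  then have "\<not> E \<subseteq> (\<Union>i\<in>I. ?U i)"
    using card_mono[of "\<Union>i\<in>I. ?U i" E] assms(1,2) by fastforce
  then show ?thesis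
    by blast
qed

section \<open>A copy of K_{s,t} that is rainbow for none of its vertices\<close>

lemma copy_of_complete_bipartite:
  assumes "L \<subseteq> {1..n}" "R \<subseteq> {1..n}" "L \<inter> R = {}" "card L = s" "card R = t"
  shows "copy_of (L \<union> R, {{l, r} | l r. l \<in> L \<and> r \<in> R}) (complete_bipartite s t)
           (complete_graph n)"
proof -
  have "finite L" "finite R"
    using assms finite_subset by blast+
  then obtain p q where p: "bij_betw p {1..s} L" and q: "bij_betw q {1..t} R"
    using finite_same_card_bij[of "{1..s}" L] finite_same_card_bij[of "{1..t}" R] assms by auto
  have pL: "p ` {1..s} = L" and qR: "q ` {1..t} = R"
    using p q by (auto simp: bij_betw_def)
  have "bij_betw (case_sum p q) ({1..s} <+> {1..t}) (L \<union> R)"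
    unfolding bij_betw_def
  proof
    have "p i \<noteq> q j" if "i \<in> {1..s}" "j \<in> {1..t}" for i j
      using that pL qR assms(3) by blast
    moreover have "inj_on p {1..s}" "inj_on q {1..t}"
      using p q by (simp_all add: bij_betw_def)
    ultimately show "inj_on (case_sum p q) ({1..s} <+> {1..t})"
      by (intro inj_onI) (elim PlusE; simp add: inj_on_eq_iff; metis)
    show "case_sum p q ` ({1..s} <+> {1..t}) = L \<union> R"
      unfolding Plus_def image_Un image_image using pL qR by simp
  qed
  moreover have "{{l, r} | l r. l \<in> L \<and> r \<in> R}
      = (\<lambda>e. case_sum p q ` e) ` {{Inl i, Inr j} | i j. i \<in> {1..s} \<and> j \<in> {1..t}}"
  proof -
    have "{{Inl i, Inr j} | i j. i \<in> {1..s} \<and> j \<in> {1..t}}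
        = (\<lambda>(i, j). {Inl i, Inr j}) ` ({1..s} \<times> {1..t})"
      unfolding image_def case_prod_unfold by fastforce
    moreover have "{{l, r} | l r. l \<in> L \<and> r \<in> R} = (\<lambda>(i, j). {p i, q j}) ` ({1..s} \<times> {1..t})"
      unfolding pL[symmetric] qR[symmetric] image_def case_prod_unfold by fastforce
    ultimately show ?thesis
      by (simp add: image_image case_prod_unfold)
  qed
  ultimately have "isomorphic (complete_bipartite s t) (L \<union> R, {{l, r} | l r. l \<in> L \<and> r \<in> R})"
    unfolding isomorphic_def complete_bipartite_def by auto
  moreover have "card {l, r} = 2" if "l \<in> L" "r \<in> R" for l r
    using that assms(3) by (subst card_2_iff) blast
  then have "subgraph (L \<union> R, {{l, r} | l r. l \<in> L \<and> r \<in> R}) (complete_graph n)"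
    using assms(1,2) by (auto simp: subgraph_def simple_graph_def complete_graph_def)
  ultimately show ?thesis
    by (simp add: copy_of_def)
qed

lemma obtain_superset_with_card:
  assumes "A \<subseteq> B" "finite B" "card A \<le> m" "m \<le> card B"
  obtains X where "A \<subseteq> X" "X \<subseteq> B" "card X = m"
  using exists_subset_between[of A m B] assms by auto

text \<open>Here \<open>m\<close> is the size of each half of \<open>S\<close>. The bound on
  \<open>4 * K * (2 * m + 2)\<close> makes the cherry monochromatic often enough,
  \<open>3 * K < m * m\<close> provides the commonly repeated edge, and \<open>s, t \<le> m\<close>
  leaves room to fill up both sides.\<close>

lemma not_locally_rainbow_complete_bipartite:
  assumes s: "5 \<le> s" "s \<le> m" and t: "6 \<le> t" "t \<le> m"
    and K: "0 < K" "2 * K < n" and m: "4 * K * (2 * m + 2) < n" "3 * K < m * m"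
    and f: "\<And>v e. v \<in> {1..n} \<Longrightarrow> e \<subseteq> {1..n} \<Longrightarrow> card e = 2 \<Longrightarrow> f v e \<in> {1..K}"
  shows "\<exists>T. copy_of T (complete_bipartite s t) (complete_graph n) \<and>
           (\<forall>v\<in>verts T. \<not> inj_on (f v) (edges T))"
proof -
  have f': "f v {y, z} \<in> {1..K}" if "v \<in> {1..n}" "y \<in> {1..n}" "z \<in> {1..n}" "y \<noteq> z" for v y z
    using that by (intro f) auto
  \<comment> \<open>The ends of the cherry will come from \<open>{1..2*K}\<close>, which misses
    \<open>n\<close> because \<open>2 * K < n\<close>.\<close>
  define x where "x = n"
  have x: "x \<in> {1..n}"
    using K by (simp add: x_def)
  \<comment> \<open>With \<open>2 * K\<close> edges at \<open>x\<close> and \<open>K\<close> colors,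
    each of the \<open>n\<close> vertices sees at least \<open>K\<close> monochromatic pairs. Spread
    over at most \<open>4 * K^2\<close> pairs, this averages at least \<open>n / (4 * K)\<close>,
    which exceeds \<open>2 * m + 2\<close>.\<close>
  have "\<exists>a\<in>{1..2*K}. \<exists>b\<in>{1..2*K}. a \<noteq> b \<and> 2 * m + 2 < card {v \<in> {1..n}. f v {x, a} = f v {x, b}}"
  proof (rule exists_pair_often_monochromatic[where C = "{1..K}"])
    show "(\<lambda>y. f v {x, y}) ` {1..2 * K} \<subseteq> {1..K}" if "v \<in> {1..n}" for v
    proof
      fix c assume "c \<in> (\<lambda>y. f v {x, y}) ` {1..2 * K}"
      then obtain y where "y \<in> {1..2*K}" "c = f v {x, y}" by blast
      then show "c \<in> {1..K}" using f'[OF that x, of y] K by (simp add: x_def)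
    qed
    have "4 * K * (2 * m + 2) * K < n * K"
      using m K by simp
    then show "card {1..2 * K} * card {1..2 * K} * (2 * m + 2)
        < card {1..n} * (card {1..2 * K} - card {1..K})"
      by (simp add: algebra_simps)
  qed auto
  then obtain a b where ab: "a \<in> {1..2*K}" "b \<in> {1..2*K}" "a \<noteq> b"
    and big: "2 * m + 2 < card {v \<in> {1..n}. f v {x, a} = f v {x, b}}"
    by blast
  have ab': "a \<in> {1..n}" "b \<in> {1..n}" "x \<noteq> a" "x \<noteq> b"
    using ab K by (auto simp: x_def)
  \<comment> \<open>More than \<open>2 * m + 2\<close> vertices see the cherry in one color, so at
    least \<open>2 * m\<close> remain once \<open>x\<close>, \<open>a\<close>, \<open>b\<close> are
    removed.\<close>
  define S where "S = {v \<in> {1..n}. f v {x, a} = f v {x, b}} - {x, a, b}"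
  have "card {v \<in> {1..n}. f v {x, a} = f v {x, b}} - card {x, a, b} \<le> card S"
    unfolding S_def by (rule diff_card_le_card_Diff) simp
  moreover have "card {x, a, b} = 3"
    using ab ab' by auto
  ultimately have "2 * m \<le> card S"
    using big by simp
  obtain S1 where S1: "S1 \<subseteq> S" "card S1 = m" "finite S1"
    using obtain_subset_with_card_n[of m S] \<open>2 * m \<le> card S\<close> by auto
  have "m \<le> card (S - S1)"
    using S1 \<open>2 * m \<le> card S\<close> by (simp add: card_Diff_subset)
  then obtain S2 where S2: "S2 \<subseteq> S - S1" "card S2 = m" "finite S2"
    using obtain_subset_with_card_n by blast
  \<comment> \<open>Edges are represented by pairs with first end in \<open>S1\<close>, so that
    \<open>e\<close> and all its partners cross between the same two sides.\<close>
  have "\<exists>e\<in>S1 \<times> S2. \<forall>i\<in>{x, a, b}. \<exists>e'\<in>S1 \<times> S2. e' \<noteq> e \<and>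
          f i {fst e', snd e'} = f i {fst e, snd e}"
  proof (rule exists_commonly_repeated[where C = "{1..K}"])
    show "(\<lambda>e. f i {fst e, snd e}) ` (S1 \<times> S2) \<subseteq> {1..K}" if i: "i \<in> {x, a, b}" for i
    proof
      fix c assume "c \<in> (\<lambda>e. f i {fst e, snd e}) ` (S1 \<times> S2)"
      then obtain y z where "y \<in> S1" "z \<in> S2" "c = f i {y, z}" by auto
      moreover from this have "y \<in> {1..n}" "z \<in> {1..n}" "y \<noteq> z"
        using S1 S2 by (auto simp: S_def)
      moreover have "i \<in> {1..n}"
        using i x ab' by blast
      ultimately show "c \<in> {1..K}" using f' by blast
    qed
    show "card {x, a, b} * card {1..K} < card (S1 \<times> S2)"
      using \<open>card {x, a, b} = 3\<close> S1 S2 m by (simp add: card_cartesian_product)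
  qed (use S1 S2 in auto)
  then obtain e g where e: "e \<in> S1 \<times> S2"
    and g: "\<And>i. i \<in> {x, a, b} \<Longrightarrow> g i \<in> S1 \<times> S2 \<and> g i \<noteq> e \<and>
          f i {fst (g i), snd (g i)} = f i {fst e, snd e}"
    by metis
  \<comment> \<open>The partners may coincide or share ends, hence only upper bounds on the number
    of ends are available.\<close>
  let ?F = "{e, g x, g a, g b}"
  have F: "?F \<subseteq> S1 \<times> S2"
    using e g by auto
  have "card ?F \<le> 4"
    by (simp add: card_insert_if)
  moreover have "finite ?F"
    by simp
  ultimately have c4: "card (fst ` ?F) \<le> 4" "card (snd ` ?F) \<le> 4"
    by (meson card_image_le order_trans)+
  have out: "x \<notin> S1" "a \<notin> S2" "b \<notin> S2"
    using S1 S2 by (auto simp: S_def)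
  \<comment> \<open>The center \<open>x\<close> joins the side of \<open>S1\<close>, and
    \<open>a\<close>, \<open>b\<close> join that of \<open>S2\<close>, so both edges of the cherry
    cross. Together with at most four ends of \<open>?F\<close> per side this explains the
    thresholds \<open>5 = 1 + 4\<close> and \<open>6 = 2 + 4\<close>.\<close>
  obtain L where L: "insert x (fst ` ?F) \<subseteq> L" "L \<subseteq> insert x S1" "card L = s"
  proof (rule obtain_superset_with_card)
    show "insert x (fst ` ?F) \<subseteq> insert x S1"
      using F by auto
    show "card (insert x (fst ` ?F)) \<le> s"
      using c4 s card_insert_le_m1[of 5 "fst ` ?F" x] by linarith
    show "s \<le> card (insert x S1)"
      using s S1 out by simp
  qed (use S1 in auto)
  obtain R where R: "insert a (insert b (snd ` ?F)) \<subseteq> R" "R \<subseteq> insert a (insert b S2)" "card R = t"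
  proof (rule obtain_superset_with_card)
    show "insert a (insert b (snd ` ?F)) \<subseteq> insert a (insert b S2)"
      using F by auto
    show "card (insert a (insert b (snd ` ?F))) \<le> t"
      using c4 t card_insert_le_m1[of 5 "snd ` ?F" b]
        card_insert_le_m1[of 6 "insert b (snd ` ?F)" a] by linarith
    show "t \<le> card (insert a (insert b S2))"
      using t S2 out ab by simp
  qed (use S2 in auto)
  let ?T = "(L \<union> R, {{l, r} | l r. l \<in> L \<and> r \<in> R})"
  have disj: "L \<inter> R = {}"
    using L(2) R(2) S1(1) S2(1) ab' by (auto simp: S_def)
  have sub: "L \<subseteq> {1..n}" "R \<subseteq> {1..n}"
    using L(2) R(2) S1(1) S2(1) ab' x unfolding S_def by blast+
  have "copy_of ?T (complete_bipartite s t) (complete_graph n)"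
    using copy_of_complete_bipartite[OF sub disj] L R by auto
  moreover have "\<not> inj_on (f v) (edges ?T)" if v: "v \<in> verts ?T" for v
  proof (cases "v \<in> {x, a, b}")
    case True
    let ?e = "{fst e, snd e}" and ?e' = "{fst (g v), snd (g v)}"
    have in_T: "fst e \<in> L" "snd e \<in> R" "fst (g v) \<in> L" "snd (g v) \<in> R"
      using True L(1) R(1) by auto
    \<comment> \<open>Distinct pairs could still be the same edge with its ends swapped;
      disjointness of the sides excludes this.\<close>
    then have "?e' \<noteq> ?e"
      using disj g[OF True] by (auto simp: doubleton_eq_iff prod_eq_iff)
    moreover have "?e' = ?e" if "inj_on (f v) (edges ?T)"
      using g[OF True] in_T by (intro inj_onD[OF that]) auto
    ultimately show ?thesis
      by blast
  next
    case False
    then have "v \<in> S"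
      using v L(2) R(2) S1(1) S2(1) by auto
    then have "{x, a} = {x, b}" if "inj_on (f v) (edges ?T)"
      using L(1) R(1) by (intro inj_onD[OF that]) (auto simp: S_def)
    moreover have "{x, a} \<noteq> {x, b}"
      using ab ab' by (auto simp: doubleton_eq_iff)
    ultimately show ?thesis
      by blast
  qed
  ultimately show ?thesis
    by blast
qed

section \<open>Choice of parameters and asymptotics\<close>

lemma local_rainbow_number_complete_bipartite_gt:
  fixes q :: real
  assumes "5 \<le> s" "6 \<le> t" "6 \<le> q" "real s \<le> q" "real t \<le> q" and n: "real n = q ^ 3"
  shows "q\<^sup>2 / 30 < real (local_rainbow_number n (complete_bipartite s t))"
proof (rule ccontr)
  assume less: "\<not> ?thesis"
  define k where "k = local_rainbow_number n (complete_bipartite s t)"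
  \<comment> \<open>A coloring with \<open>k\<close> colors also uses colors from
    \<open>{1..K}\<close>, and \<open>K\<close> is positive since
    \<open>q^2 \<ge> 36\<close>.\<close>
  define K where "K = nat \<lfloor>q\<^sup>2 / 30\<rfloor>"
  define m where "m = nat \<lceil>q\<rceil>"
  have "real k \<le> q\<^sup>2 / 30"
    using less by (simp add: k_def)
  then have "k \<le> K"
    unfolding K_def by linarith
  \<comment> \<open>The last inequality absorbs the quadratic term caused by rounding
    \<open>q\<close> up to \<open>m\<close> and by the summand \<open>2\<close> in
    \<open>2 * m + 2\<close>.\<close>
  have q2: "6 * q \<le> q\<^sup>2" "36 \<le> q\<^sup>2" "6 * q\<^sup>2 \<le> q ^ 3"
    using assms(3) mult_mono[of 6 q 6 q]
    by (simp_all add: power2_eq_square power3_eq_cube)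
  have K: "real K \<le> q\<^sup>2 / 30" "0 < K"
    unfolding K_def using q2 by linarith+
  have m: "q \<le> real m" "real m \<le> q + 1"
    unfolding m_def using assms(3) by linarith+
  \<comment> \<open>Nonemptiness ensures that the \<open>LEAST\<close> is attained by an actual
    family of colorings.\<close>
  have "verts (complete_bipartite s t) \<noteq> {}"
    using assms(1) by (auto simp: complete_bipartite_def)
  then obtain f where f: "locally_rainbow n (complete_bipartite s t) k f"
    using LeastI_ex[OF locally_rainbow_exists[of "complete_bipartite s t" n]]
    unfolding k_def local_rainbow_number_def by blast
  have "\<exists>T. copy_of T (complete_bipartite s t) (complete_graph n) \<and>
           (\<forall>v\<in>verts T. \<not> inj_on (f v) (edges T))"
  proof (rule not_locally_rainbow_complete_bipartite)
    show "s \<le> m" "t \<le> m"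
      using assms m by linarith+
    have "real (2 * K) < real n"
      unfolding n using K q2 by simp
    then show "2 * K < n"
      by linarith
    have "real (4 * K * (2 * m + 2)) \<le> 4 * (q\<^sup>2 / 30) * (2 * (q + 1) + 2)"
      unfolding of_nat_mult of_nat_add using K m by (intro mult_mono add_mono) auto
    also have "\<dots> = (8 * q ^ 3 + 16 * q\<^sup>2) / 30"
      by (simp add: power2_eq_square power3_eq_cube algebra_simps)
    also have "\<dots> < real n"
      unfolding n using q2 by simp
    finally show "4 * K * (2 * m + 2) < n"
      by linarith
    have "3 * real K < q\<^sup>2"
      using K q2 by linarith
    also have "\<dots> \<le> real m * real m"
      using m assms(3) by (simp add: power2_eq_square mult_mono)
    finally have "real (3 * K) < real (m * m)"
      by simp
    then show "3 * K < m * m"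
      by linarith
    show "f v e \<in> {1..K}" if "v \<in> {1..n}" "e \<subseteq> {1..n}" "card e = 2" for v e
    proof -
      have "\<forall>v\<in>{1..n}. f v \<in> edges (complete_graph n) \<rightarrow> {1..k}"
        using f by (simp add: locally_rainbow_def complete_graph_def)
      moreover have "e \<in> edges (complete_graph n)"
        using that by (simp add: complete_graph_def)
      ultimately have "f v e \<in> {1..k}"
        using that(1) by blast
      then show ?thesis
        using \<open>k \<le> K\<close> by auto
    qed
  qed (use assms K in auto)
  then show False
    using f unfolding locally_rainbow_def by blast
qed

theorem theorem3:
  fixes s t :: nat
  assumes "7 \<le> s" and "s \<le> t"
  shows "(\<lambda>n. real (local_rainbow_number n (complete_bipartite s t)))
           \<in> \<Omega>(\<lambda>n. real n powr (2 / 3))"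
proof (rule landau_omega.bigI[of "1 / 30"])
  show "\<forall>\<^sub>F n in sequentially. norm (real (local_rainbow_number n (complete_bipartite s t)))
          \<ge> 1 / 30 * norm (real n powr (2 / 3))"
    \<comment> \<open>From \<open>t ^ 3 \<le> n\<close> the cube root \<open>q\<close> of
      \<open>n\<close> is at least \<open>t\<close>, hence at least \<open>s\<close> and at least
      \<open>7\<close>.\<close>
    using eventually_ge_at_top[of "t ^ 3"]
  proof eventually_elim
    case (elim n)
    define q where "q = real n powr (1 / 3)"
    have "0 < t ^ 3"
      using assms by simp
    then have "0 < n"
      using elim by linarith
    then have n: "real n = q ^ 3" and q2: "real n powr (2 / 3) = q\<^sup>2"
      by (simp_all add: q_def powr_power)
    have "real t ^ 3 \<le> q ^ 3"
      using elim n by (metis of_nat_le_iff of_nat_power)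
    then have "real t \<le> q"
      \<comment> \<open>The rule has exponent \<open>Suc n\<close>, so the instance \<open>2\<close>
        is the one for cubes.\<close>
      by (rule power_le_imp_le_base[of _ 2, simplified]) (simp add: q_def)
    then have "q\<^sup>2 / 30 < real (local_rainbow_number n (complete_bipartite s t))"
      using assms n by (intro local_rainbow_number_complete_bipartite_gt) auto
    then show ?case
      by (simp add: q2)
  qed
qed simp

end
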